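(* Let $f\colon\mathbb{D}\to\mathbb{D}$ be a non-elliptic map with Denjoy--Wolff point $\tau\in\partial\mathbb{D}$ and whose Koenigs domain is not the whole complex plane. For any $z\in\mathbb{D}$, we have that $$\limsup_{n\to+\infty}\frac{\log|f^n(z)-\tau|}{\log n}\le -\frac{1}{4}.$$ If, in addition, $\{f^n(z_0)\}$ converges to $\tau$ non-tangentially for some $z_0\in\mathbb{D}$, then for any $z\in\mathbb{D}$ $$\limsup_{n\to+\infty}\frac{\log|f^n(z)-\tau|}{\log n}\le -\frac{1}{2}.$$
   Context: $\mathbb{D}$ is the open unit disc and $\mathbb{N}=\{1,2,\dots\}$. A holomorphic map $f\colon\mathbb{D}\to\mathbb{D}$ is non-elliptic if it has no fixed point in $\mathbb{D}$; then there is a unique $\tau\in\partial\mathbb{D}$, the Denjoy--Wolff point of $f$, such that the iterates $f^n(z)$ converge to $\tau$ for all $z\in\mathbb{D}$. A sequence $\{z_n\}\subseteq\mathbb{D}$ converging to $\sigma\in\partial\mathbb{D}$ converges non-tangentially if there is $R>1$ with $|\sigma-z_n|<R(1-|z_n|)$ for all $n$. A domain $\Omega\subseteq\mathbb{C}$ is starlike at infinity if $\Omega+t\subseteq\Omega$ for all $t\ge 0$; it is asymptotically starlike at infinity if $\Omega+1\subseteq\Omega$ and $\bigcup_{n=1}^\infty(\Omega-n)$ is starlike at infinity. A simply connected domain $U\subseteq\mathbb{D}$ is a fundamental domain of $f$ if $f$ is univalent on $U$, $f(U)\subseteq U$ and $\bigcup_{n\in\mathbb{N}}f^{-n}(U)=\mathbb{D}$.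 For a non-elliptic $f$, a Koenigs domain and a Koenigs function are a domain $\Omega$ asymptotically starlike at infinity and an onto holomorphic map $h\colon\mathbb{D}\to\Omega$ with $h\circ f=h+1$ and such that $h$ is univalent on some fundamental domain of $f$. Such a pair exists and is unique up to translation. *)

theory Defs
  imports "HOL-Complex_Analysis.Complex_Analysis"
begin

abbreviation unit_disc :: "complex set" where
  "unit_disc \<equiv> ball 0 1"

definition self_map_disc :: "(complex \<Rightarrow> complex) \<Rightarrow> bool" where
  "self_map_disc f \<longleftrightarrow> f holomorphic_on unit_disc \<and> f ` unit_disc \<subseteq> unit_disc"

definition non_elliptic :: "(complex \<Rightarrow> complex) \<Rightarrow> bool" where
  "non_elliptic f \<longleftrightarrow> self_map_disc f \<and> (\<forall>z\<in>unit_disc. f z \<noteq> z)"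

definition denjoy_wolff_point :: "(complex \<Rightarrow> complex) \<Rightarrow> complex \<Rightarrow> bool" where
  "denjoy_wolff_point f \<tau> \<longleftrightarrow>
     \<tau> \<in> sphere 0 1 \<and> (\<forall>z\<in>unit_disc. (\<lambda>n. (f ^^ n) z) \<longlonglongrightarrow> \<tau>)"

definition converges_nontangentially :: "(nat \<Rightarrow> complex) \<Rightarrow> complex \<Rightarrow> bool" where
  "converges_nontangentially u \<sigma> \<longleftrightarrow>
     (\<forall>n. u n \<in> unit_disc) \<and> \<sigma> \<in> sphere 0 1 \<and> u \<longlonglongrightarrow> \<sigma> \<and>
     (\<exists>R>1. \<forall>n. cmod (\<sigma> - u n) < R * (1 - cmod (u n)))"

definition is_domain :: "complex set \<Rightarrow> bool" where
  "is_domain S \<longleftrightarrow> open S \<and> connected S \<and> S \<noteq> {}"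

definition starlike_at_infinity :: "complex set \<Rightarrow> bool" where
  "starlike_at_infinity S \<longleftrightarrow>
     is_domain S \<and> (\<forall>t\<ge>0. (\<lambda>w. w + complex_of_real t) ` S \<subseteq> S)"

definition asymptotically_starlike_at_infinity :: "complex set \<Rightarrow> bool" where
  "asymptotically_starlike_at_infinity S \<longleftrightarrow>
     is_domain S \<and> (\<lambda>w. w + 1) ` S \<subseteq> S \<and>
     starlike_at_infinity (\<Union>n\<in>{1::nat..}. (\<lambda>w. w - of_nat n) ` S)"

text \<open>The sets \<open>f\<^sup>-\<^sup>n(U)\<close> are preimages under iterates of \<open>f\<close> as a self-map of the disc,
  hence the restriction of the points \<open>z\<close> to \<open>unit_disc\<close>.\<close>

definition fundamental_domain :: "(complex \<Rightarrow> complex) \<Rightarrow> complex set \<Rightarrow> bool" where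
  "fundamental_domain f U \<longleftrightarrow>
     is_domain U \<and> simply_connected U \<and> U \<subseteq> unit_disc \<and>
     inj_on f U \<and> f ` U \<subseteq> U \<and>
     (\<Union>n\<in>{1::nat..}. {z \<in> unit_disc. (f ^^ n) z \<in> U}) = unit_disc"

text \<open>For non-elliptic \<open>f\<close> such a pair exists and is unique up to translation, so it is treated
  as a relation rather than selected by a choice operator.\<close>

definition koenigs_pair ::
  "(complex \<Rightarrow> complex) \<Rightarrow> complex set \<Rightarrow> (complex \<Rightarrow> complex) \<Rightarrow> bool" where
  "koenigs_pair f \<Omega> h \<longleftrightarrow>
     asymptotically_starlike_at_infinity \<Omega> \<and>
     h holomorphic_on unit_disc \<and> h ` unit_disc = \<Omega> \<and>
     (\<forall>z\<in>unit_disc. h (f z) = h z + 1) \<and>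
     (\<exists>U. fundamental_domain f U \<and> inj_on h U)"

end

theory Submission
  imports Defs
begin

text \<open>
  Pick \<open>p \<notin> \<Omega>\<close>. Since \<open>\<Omega> + 1 \<subseteq> \<Omega>\<close>, the function \<open>H = h - p\<close> omits \<open>0, -1, -2, \<dots>\<close> on the disc, while
  \<open>H (f\<^sup>n z) = H z + n\<close>. So a bound on the growth of a function that omits these values forces
  \<open>f\<^sup>n z\<close> to approach the circle at a definite rate.

  A function that omits the whole half-line \<open>(-\<infinity>, 0]\<close> is the square of a function with positive
  real part and grows at most like \<open>(1 - |z|)\<^sup>-\<^sup>2\<close>; infinitesimally,
  \<open>|g' 0| \<le> 4 |g 0|\<close> (\<open>deriv_slit_plane\<close>). Seen from a point \<open>w\<close> far away, the integers
  \<open>0, -1, -2, \<dots>\<close> rescaled by \<open>|w|\<close> fill up this half-line, so for large \<open>|g 0|\<close> the same inequality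
  holds with any constant \<open>K > 4\<close> in place of \<open>4\<close>. This is made precise by a normal-families
  argument (\<open>asymptotic_Landau\<close>): Schottky's theorem gives compactness, and Hurwitz's theorem
  shows that a nonconstant limit of the rescaled functions omits the half-line. Transporting the
  inequality by disc automorphisms and integrating it along radii gives
  \<open>|H z| \<le> C (1 - |z|)\<^sup>-\<^sup>\<kappa>\<close> for every \<open>\<kappa> > 2\<close> (\<open>growth_omitting_nonpos_integers\<close>), hence
  \<open>1 - |f\<^sup>n z| \<le> C n\<^sup>-\<^sup>\<beta>\<close> for every \<open>\<beta> < 1/2\<close> (\<open>koenigs_orbit_rate\<close>).

  It remains to compare \<open>|f\<^sup>n z - \<tau>|\<close> with \<open>1 - |f\<^sup>n z|\<close>. By Wolff's lemma every orbit stays in a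
  horodisc at \<open>\<tau>\<close>, where \<open>|w - \<tau>|\<^sup>2 \<le> C (1 - |w|)\<close> (\<open>orbit_horodisc\<close>); this halves the exponent and
  gives \<open>-1/4\<close>. If some orbit is non-tangential, then \<open>|w - \<tau>| \<le> C (1 - |w|)\<close> along it, and the
  Schwarz-Pick lemma carries the exponent \<open>-1/2\<close> over to every other orbit, which stays at bounded
  hyperbolic distance from it (\<open>orbits_comparable\<close>).
\<close>

section \<open>Schwarz-Pick estimates and horodiscs\<close>

lemma Moebius_defect:
  assumes "norm w < 1" "norm z < 1"
  shows "1 - (norm (Moebius_function 0 w z))\<^sup>2 =
         (1 - (norm w)\<^sup>2) * (1 - (norm z)\<^sup>2) / (norm (1 - cnj w * z))\<^sup>2"
    and "1 - cnj w * z \<noteq> 0"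
proof -
  show nz: "1 - cnj w * z \<noteq> 0"
    by (metis assms complex_mod_cnj mult.right_neutral norm_mult_less norm_one
        order_less_irrefl right_minus_eq)
  have "(norm (1 - cnj w * z))\<^sup>2 - (norm (z - w))\<^sup>2 = (1 - (norm w)\<^sup>2) * (1 - (norm z)\<^sup>2)"
    unfolding cmod_power2 by (simp add: power2_eq_square algebra_simps)
  then show "1 - (norm (Moebius_function 0 w z))\<^sup>2 =
         (1 - (norm w)\<^sup>2) * (1 - (norm z)\<^sup>2) / (norm (1 - cnj w * z))\<^sup>2"
    using nz by (simp add: Moebius_function_simple norm_divide power_divide field_simps)
qed

lemma Schwarz_Pick:
  assumes hol: "g holomorphic_on ball 0 1" and maps: "g ` ball 0 1 \<subseteq> ball 0 1"
    and w: "norm w < 1" and z: "norm z < 1"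
  shows "norm (Moebius_function 0 (g w) (g z)) \<le> norm (Moebius_function 0 w z)"
proof -
  define F where "F = Moebius_function 0 (g w) \<circ> g \<circ> Moebius_function 0 (-w)"
  have gw: "norm (g w) < 1"
    using maps w by (auto simp: image_subset_iff)
  have M: "Moebius_function 0 (-w) ` ball 0 1 \<subseteq> ball 0 1"
    using Moebius_function_norm_lt_1[of "-w"] w by auto
  have "F holomorphic_on ball 0 1"
    unfolding F_def
    by (intro holomorphic_on_compose holomorphic_on_subset[OF hol]
        holomorphic_on_subset[OF Moebius_function_holomorphic[OF gw]] Moebius_function_holomorphic)
      (use M maps w in auto)
  moreover have "F 0 = 0"
    by (simp add: F_def Moebius_function_of_zero Moebius_function_eq_zero)
  moreover have "norm (F u) < 1" if "norm u < 1" for u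
    unfolding F_def o_def
    by (rule Moebius_function_norm_lt_1[OF gw]) (use M maps that in \<open>auto simp: image_subset_iff\<close>)
  ultimately have "norm (F (Moebius_function 0 w z)) \<le> norm (Moebius_function 0 w z)"
    by (rule Schwarz_Lemma(1)) (use Moebius_function_norm_lt_1[OF w z] in auto)
  then show ?thesis
    using Moebius_function_compose[of "-w" w z] w z by (simp add: F_def)
qed

text \<open>
  The Schwarz-Pick lemma at a fixed point, with the factor \<open>1 - |w|\<^sup>2\<close> cancelled. In this form the
  inequality survives the passage to the limit \<open>|w| \<rightarrow> 1\<close>, where pseudo-hyperbolic discs turn into
  horodiscs.
\<close>

lemma fixed_point_disc_invariant:
  assumes hol: "g holomorphic_on ball 0 1" and maps: "g ` ball 0 1 \<subseteq> ball 0 1"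
    and w: "norm w < 1" and z: "norm z < 1" and fixed: "g w = w"
  shows "(norm (1 - cnj w * g z))\<^sup>2 * (1 - (norm z)\<^sup>2) \<le> (norm (1 - cnj w * z))\<^sup>2 * (1 - (norm (g z))\<^sup>2)"
proof -
  have gz: "norm (g z) < 1"
    using maps z by (auto simp: image_subset_iff)
  have "norm (Moebius_function 0 w (g z)) \<le> norm (Moebius_function 0 w z)"
    using Schwarz_Pick[OF hol maps w z] fixed by simp
  then have "1 - (norm (Moebius_function 0 w z))\<^sup>2 \<le> 1 - (norm (Moebius_function 0 w (g z)))\<^sup>2"
    by (simp add: power_mono)
  moreover have "1 - (norm w)\<^sup>2 > 0"
    using w by (simp add: power_less_one_iff)
  ultimately have "(1 - (norm z)\<^sup>2) / (norm (1 - cnj w * z))\<^sup>2 \<le>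
      (1 - (norm (g z))\<^sup>2) / (norm (1 - cnj w * g z))\<^sup>2"
    unfolding Moebius_defect(1)[OF w z] Moebius_defect(1)[OF w gz]
    by (metis mult_le_cancel_left_pos times_divide_eq_right)
  then show ?thesis
    using Moebius_defect(2)[OF w z] Moebius_defect(2)[OF w gz] by (simp add: field_simps)
qed

text \<open>
  Wolff's lemma. The maps \<open>r f\<close> with \<open>r < 1\<close> have fixed points in the disc by Brouwer's
  theorem. As \<open>r \<rightarrow> 1\<close> these accumulate at a point \<open>\<sigma>\<close> of the closed disc, which would be a fixed point
  of \<open>f\<close> if it were interior. Hence \<open>\<sigma>\<close> lies on the circle, and the discs about the fixed points that
  \<open>r f\<close> maps into themselves converge to horodiscs at \<open>\<sigma>\<close>.
\<close>

lemma Wolff_horodisc: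
  assumes ne: "non_elliptic f"
  obtains \<sigma> where "norm \<sigma> = 1"
    "\<And>z. norm z < 1 \<Longrightarrow>
       (norm (1 - cnj \<sigma> * f z))\<^sup>2 * (1 - (norm z)\<^sup>2) \<le> (norm (1 - cnj \<sigma> * z))\<^sup>2 * (1 - (norm (f z))\<^sup>2)"
proof -
  have hol: "f holomorphic_on ball 0 1" and maps: "f ` ball 0 1 \<subseteq> ball 0 1"
    and nofix: "\<And>z. norm z < 1 \<Longrightarrow> f z \<noteq> z"
    using ne by (auto simp: non_elliptic_def self_map_disc_def)
  define r where "r k = 1 - 1 / real (k + 2)" for k
  have r: "0 < r k" "r k < 1" for k
    by (auto simp: r_def field_simps)
  have rlim: "r \<longlonglongrightarrow> 1"
    unfolding r_def
    using tendsto_diff[OF tendsto_const LIMSEQ_ignore_initial_segment[OF lim_1_over_n, of 2], of 1] by simp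
  have "\<exists>w. norm w < 1 \<and> of_real (r k) * f w = w" for k
  proof -
    \<comment> \<open>On the closed disc of radius \<open>r k\<close>, unlike on the closed unit disc, \<open>f\<close> is known to be continuous.\<close>
    have sub: "cball 0 (r k) \<subseteq> ball (0::complex) 1"
      using r[of k] by auto
    have "continuous_on (cball 0 (r k)) (\<lambda>z. of_real (r k) * f z)"
      by (intro continuous_intros holomorphic_on_imp_continuous_on holomorphic_on_subset[OF hol] sub)
    moreover have "norm (of_real (r k) * f z) \<le> r k" if "z \<in> cball 0 (r k)" for z
    proof -
      have "norm (f z) < 1"
        using maps sub that by (metis image_subset_iff mem_ball_0 subsetD)
      then show ?thesis
        using r[of k] by (simp add: norm_mult)
    qed
    ultimately obtain w where "w \<in> cball 0 (r k)" "of_real (r k) * f w = w"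
      using brouwer_ball[of "r k" 0 "\<lambda>z. of_real (r k) * f z"] r[of k] by auto
    then show ?thesis
      using r[of k] by (intro exI[of _ w]) auto
  qed
  then obtain w where w: "\<And>k. norm (w k) < 1" "\<And>k. of_real (r k) * f (w k) = w k"
    by metis
  have "compact (cball (0::complex) 1)" "\<forall>k. w k \<in> cball 0 1"
    using w(1) by (auto simp: less_imp_le)
  then obtain \<sigma> s where \<sigma>: "norm \<sigma> \<le> 1" and s: "strict_mono s" and ws: "(w \<circ> s) \<longlonglongrightarrow> \<sigma>"
    unfolding compact_def by (metis mem_cball_0)
  have rs: "(\<lambda>k. r (s k)) \<longlonglongrightarrow> 1"
    using LIMSEQ_subseq_LIMSEQ[OF rlim s] by (simp add: o_def)
  have ws': "(\<lambda>k. w (s k)) \<longlonglongrightarrow> \<sigma>"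
    using ws by (simp add: o_def)
  have "norm \<sigma> = 1"
  proof (rule ccontr)
    assume "norm \<sigma> \<noteq> 1"
    then have lt: "norm \<sigma> < 1"
      using \<sigma> by simp
    then have "isCont f \<sigma>"
      using hol by (metis centre_in_ball continuous_on_eq_continuous_at holomorphic_on_imp_continuous_on mem_ball_0 open_ball)
    then have "(\<lambda>k. of_real (r (s k)) * f (w (s k))) \<longlonglongrightarrow> of_real 1 * f \<sigma>"
      by (intro tendsto_intros rs isCont_tendsto_compose[OF _ ws'])
    then have "f \<sigma> = \<sigma>"
      using ws' w(2) LIMSEQ_unique by fastforce
    then show False
      using nofix lt by blast
  qed
  moreover have "(norm (1 - cnj \<sigma> * f z))\<^sup>2 * (1 - (norm z)\<^sup>2) \<le> (norm (1 - cnj \<sigma> * z))\<^sup>2 * (1 - (norm (f z))\<^sup>2)"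
    if z: "norm z < 1" for z
  proof (rule LIMSEQ_le)
    have "(\<lambda>k. (norm (1 - cnj (w (s k)) * (of_real (r (s k)) * f z)))\<^sup>2 * (1 - (norm z)\<^sup>2)) \<longlonglongrightarrow>
        (norm (1 - cnj \<sigma> * (of_real 1 * f z)))\<^sup>2 * (1 - (norm z)\<^sup>2)"
      by (intro tendsto_intros rs ws')
    then show "(\<lambda>k. (norm (1 - cnj (w (s k)) * (of_real (r (s k)) * f z)))\<^sup>2 * (1 - (norm z)\<^sup>2)) \<longlonglongrightarrow>
        (norm (1 - cnj \<sigma> * f z))\<^sup>2 * (1 - (norm z)\<^sup>2)"
      by simp
    have "(\<lambda>k. (norm (1 - cnj (w (s k)) * z))\<^sup>2 * (1 - (norm (of_real (r (s k)) * f z))\<^sup>2)) \<longlonglongrightarrow>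
        (norm (1 - cnj \<sigma> * z))\<^sup>2 * (1 - (norm (of_real 1 * f z))\<^sup>2)"
      by (intro tendsto_intros rs ws')
    then show "(\<lambda>k. (norm (1 - cnj (w (s k)) * z))\<^sup>2 * (1 - (norm (of_real (r (s k)) * f z))\<^sup>2)) \<longlonglongrightarrow>
        (norm (1 - cnj \<sigma> * z))\<^sup>2 * (1 - (norm (f z))\<^sup>2)"
      by simp
    have "norm (of_real (r k) * f u) < 1" if "norm u < 1" for k u
    proof -
      have "norm (f u) < 1"
        using maps that by (auto simp: image_subset_iff)
      then have "r k * norm (f u) < 1 * 1"
        using r[of k] by (intro mult_strict_mono) auto
      then show ?thesis
        using r[of k] by (simp add: norm_mult)
    qed
    then have "(norm (1 - cnj (w k) * (of_real (r k) * f z)))\<^sup>2 * (1 - (norm z)\<^sup>2) \<le>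
        (norm (1 - cnj (w k) * z))\<^sup>2 * (1 - (norm (of_real (r k) * f z))\<^sup>2)" for k
      by (intro fixed_point_disc_invariant holomorphic_intros hol w z) auto
    then show "\<exists>N. \<forall>k\<ge>N. (norm (1 - cnj (w (s k)) * (of_real (r (s k)) * f z)))\<^sup>2 * (1 - (norm z)\<^sup>2) \<le>
        (norm (1 - cnj (w (s k)) * z))\<^sup>2 * (1 - (norm (of_real (r (s k)) * f z))\<^sup>2)"
      by blast
  qed
  ultimately show thesis
    using that by blast
qed

lemma orbit_in_disc:
  fixes f :: "complex \<Rightarrow> complex"
  assumes "f ` ball 0 1 \<subseteq> ball 0 1" "norm z < 1"
  shows "norm ((f ^^ n) z) < 1"
  using assms by (induction n) (auto simp: image_subset_iff)

lemma unimodular_cnj_dist: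
  assumes "norm \<sigma> = 1"
  shows "norm (1 - cnj \<sigma> * z) = norm (z - \<sigma>)"
proof -
  have "\<sigma> * (1 - cnj \<sigma> * z) = \<sigma> - z"
    using assms complex_norm_square[of \<sigma>] by (simp add: algebra_simps)
  then show ?thesis
    by (metis assms mult_1 norm_minus_commute norm_mult)
qed

text \<open>
  An orbit stays in a horodisc at the point \<open>\<sigma>\<close> from Wolff's lemma. The closure of the horodisc meets
  the circle only at \<open>\<sigma>\<close>, so the limit \<open>\<tau>\<close> of the orbit is \<open>\<sigma>\<close>.
\<close>

lemma orbit_horodisc:
  assumes ne: "non_elliptic f" and dw: "denjoy_wolff_point f \<tau>" and z: "norm z < 1"
  shows "\<exists>C>0. \<forall>n. (norm ((f ^^ n) z - \<tau>))\<^sup>2 \<le> C * (1 - norm ((f ^^ n) z))"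
proof -
  have maps: "f ` ball 0 1 \<subseteq> ball 0 1"
    using ne by (auto simp: non_elliptic_def self_map_disc_def)
  obtain \<sigma> where \<sigma>: "norm \<sigma> = 1" and wolff:
    "\<And>z. norm z < 1 \<Longrightarrow>
       (norm (1 - cnj \<sigma> * f z))\<^sup>2 * (1 - (norm z)\<^sup>2) \<le> (norm (1 - cnj \<sigma> * z))\<^sup>2 * (1 - (norm (f z))\<^sup>2)"
    using Wolff_horodisc[OF ne] by metis
  have in_disc: "norm ((f ^^ n) z) < 1" for n
    by (rule orbit_in_disc[OF maps z])
  have pos: "1 - (norm u)\<^sup>2 > 0" if "norm u < 1" for u :: complex
    using that by (simp add: power_less_one_iff)
  define K where "K = (norm (z - \<sigma>))\<^sup>2 / (1 - (norm z)\<^sup>2)"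
  have K: "K > 0"
    unfolding K_def using pos[OF z] z \<sigma> by (intro divide_pos_pos) auto
  have horo: "(norm ((f ^^ n) z - \<sigma>))\<^sup>2 \<le> K * (1 - (norm ((f ^^ n) z))\<^sup>2)" for n
  proof (induction n)
    case 0
    then show ?case
      using pos[OF z] by (simp add: K_def)
  next
    case (Suc n)
    let ?u = "(f ^^ n) z"
    have "(norm (f ?u - \<sigma>))\<^sup>2 * (1 - (norm ?u)\<^sup>2) \<le> (norm (?u - \<sigma>))\<^sup>2 * (1 - (norm (f ?u))\<^sup>2)"
      using wolff[OF in_disc[of n]] \<sigma> by (simp add: unimodular_cnj_dist)
    also have "\<dots> \<le> K * (1 - (norm ?u)\<^sup>2) * (1 - (norm (f ?u))\<^sup>2)"
      using Suc pos[OF in_disc[of "Suc n"]] by (intro mult_right_mono) auto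
    finally show ?case
      using pos[OF in_disc[of n]] by (simp add: mult.assoc mult.commute mult.left_commute)
  qed
  have "\<sigma> = \<tau>"
  proof -
    have lim: "(\<lambda>n. (f ^^ n) z) \<longlonglongrightarrow> \<tau>" and \<tau>: "norm \<tau> = 1"
      using dw z by (auto simp: denjoy_wolff_point_def)
    have "(norm (\<tau> - \<sigma>))\<^sup>2 \<le> K * (1 - (norm \<tau>)\<^sup>2)"
    proof (rule LIMSEQ_le)
      show "(\<lambda>n. (norm ((f ^^ n) z - \<sigma>))\<^sup>2) \<longlonglongrightarrow> (norm (\<tau> - \<sigma>))\<^sup>2"
        by (intro tendsto_intros lim)
      show "(\<lambda>n. K * (1 - (norm ((f ^^ n) z))\<^sup>2)) \<longlonglongrightarrow> K * (1 - (norm \<tau>)\<^sup>2)"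
        by (intro tendsto_intros lim)
    qed (use horo in blast)
    then show ?thesis
      using \<tau> by simp
  qed
  have "(norm ((f ^^ n) z - \<tau>))\<^sup>2 \<le> 2 * K * (1 - norm ((f ^^ n) z))" for n
  proof -
    have "1 - t\<^sup>2 \<le> 2 * (1 - t)" for t :: real
      using zero_le_power2[of "t - 1"] by (simp add: power2_eq_square algebra_simps)
    then have "K * (1 - (norm ((f ^^ n) z))\<^sup>2) \<le> K * (2 * (1 - norm ((f ^^ n) z)))"
      using K by (intro mult_left_mono) auto
    then show ?thesis
      using horo[of n] \<open>\<sigma> = \<tau>\<close> by (simp add: algebra_simps)
  qed
  then show ?thesis
    using K by (intro exI[of _ "2 * K"]) auto
qed


lemma iterate_holomorphic:
  assumes "f holomorphic_on S" "f ` S \<subseteq> S"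
  shows "(f ^^ n) holomorphic_on S \<and> (f ^^ n) ` S \<subseteq> S"
proof (induction n)
  case 0
  then show ?case
    by (simp add: id_def)
next
  case (Suc n)
  then have "f \<circ> (f ^^ n) holomorphic_on S"
    using holomorphic_on_compose holomorphic_on_subset assms by metis
  moreover have "(f \<circ> (f ^^ n)) ` S \<subseteq> S"
    using Suc assms by auto
  ultimately show ?case
    unfolding funpow.simps by blast
qed

text \<open>
  The pseudo-hyperbolic distance between two orbits does not increase, and a pseudo-hyperbolic disc
  of fixed radius \<open>\<rho> < 1\<close> about \<open>u\<close> has Euclidean size comparable to \<open>1 - |u|\<close>.
\<close>

lemma orbits_comparable:
  assumes hol: "f holomorphic_on ball 0 1" and maps: "f ` ball 0 1 \<subseteq> ball 0 1"
    and w: "norm w < 1" and z: "norm z < 1"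
  shows "\<exists>C\<ge>0. \<forall>n. norm ((f ^^ n) z - (f ^^ n) w) \<le> C * (1 - norm ((f ^^ n) w))"
proof -
  define \<rho> where "\<rho> = norm (Moebius_function 0 w z)"
  have \<rho>: "0 \<le> \<rho>" "\<rho> < 1"
    using Moebius_function_norm_lt_1[OF w z] by (auto simp: \<rho>_def)
  have "norm ((f ^^ n) z - (f ^^ n) w) \<le> 2 * \<rho> / (1 - \<rho>) * (1 - norm ((f ^^ n) w))" for n
  proof -
    define u v where "u = (f ^^ n) w" and "v = (f ^^ n) z"
    have u: "norm u < 1" and v: "norm v < 1"
      using orbit_in_disc[OF maps] w z by (auto simp: u_def v_def)
    have "norm (Moebius_function 0 u v) \<le> \<rho>"
      unfolding \<rho>_def u_def v_def
      using Schwarz_Pick[OF conjunct1[OF iterate_holomorphic[OF hol maps]]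
          conjunct2[OF iterate_holomorphic[OF hol maps]] w z] by blast
    then have "norm (v - u) \<le> \<rho> * norm (1 - cnj u * v)"
      using Moebius_defect(2)[OF u v] by (simp add: Moebius_function_simple norm_divide divide_le_eq)
    also have "norm (1 - cnj u * v) \<le> 2 * (1 - norm u) + norm (v - u)"
    proof -
      have "1 - cnj u * v = of_real (1 - (norm u)\<^sup>2) - cnj u * (v - u)"
        using complex_norm_square[of u] by (simp add: algebra_simps)
      also have "norm \<dots> \<le> norm (of_real (1 - (norm u)\<^sup>2) :: complex) + norm (cnj u * (v - u))"
        by (rule norm_triangle_ineq4)
      also have "norm (of_real (1 - (norm u)\<^sup>2) :: complex) = (1 - norm u) * (1 + norm u)"
      proof -
        have "0 \<le> 1 - (norm u)\<^sup>2"
          using u by (simp add: power_le_one_iff)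
        then show ?thesis
          unfolding norm_of_real by (simp add: power2_eq_square algebra_simps)
      qed
      also have "\<dots> \<le> (1 - norm u) * 2"
        using u by (intro mult_left_mono) auto
      also have "norm (cnj u * (v - u)) \<le> norm (v - u)"
        using u by (simp add: norm_mult mult_left_le_one_le)
      finally show ?thesis
        by simp
    qed
    finally have "norm (v - u) \<le> \<rho> * (2 * (1 - norm u) + norm (v - u))"
      using \<rho> by (simp add: mult_left_mono)
    then have "norm (v - u) * (1 - \<rho>) \<le> 2 * \<rho> * (1 - norm u)"
      by (simp add: algebra_simps)
    then show ?thesis
      unfolding u_def v_def using \<rho> by (simp add: pos_le_divide_eq)
  qed
  then show ?thesis
    using \<rho> by (intro exI[of _ "2 * \<rho> / (1 - \<rho>)"]) auto
qed

section \<open>Functions omitting the non-positive integers\<close>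

text \<open>
  Schottky's theorem on the open disc: the bound is uniform over the whole family, which is what
  Montel's theorem asks for. It is obtained by shrinking the disc to radius \<open>s\<close> with \<open>t < s < 1\<close>.
\<close>

lemma Schottky_disc:
  assumes "0 < t" "t < 1"
  obtains B where "0 < B"
    "\<And>f z. \<lbrakk>f holomorphic_on ball 0 1; norm (f 0) \<le> r; \<And>z. norm z < 1 \<Longrightarrow> f z \<noteq> 0 \<and> f z \<noteq> 1; norm z \<le> t\<rbrakk>
        \<Longrightarrow> norm (f z) \<le> B"
proof -
  define s where "s = (1 + t) / 2"
  have s: "0 < s" "t < s" "s < 1" "t / s < 1" "0 < t / s"
    using assms by (auto simp: s_def field_simps)
  define B where "B = exp (pi * exp (pi * (2 + 2 * r + 12 * (t / s) / (1 - t / s))))"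
  have "norm (f z) \<le> B"
    if f: "f holomorphic_on ball 0 1" "norm (f 0) \<le> r"
      and omits: "\<And>z. norm z < 1 \<Longrightarrow> f z \<noteq> 0 \<and> f z \<noteq> 1" and z: "norm z \<le> t" for f z
  proof -
    have in_disc: "norm (of_real s * u) < 1" if "norm u \<le> 1" for u :: complex
    proof -
      have "s * norm u \<le> s * 1"
        using that s by (intro mult_left_mono) auto
      moreover have "norm (of_real s * u) = s * norm u"
        using s by (simp add: norm_mult)
      ultimately show ?thesis
        using s by linarith
    qed
    have "norm (f (of_real s * (z / of_real s))) \<le> B"
      unfolding B_def
    proof (rule Schottky[where f = "\<lambda>u. f (of_real s * u)"])
      have "f \<circ> (\<lambda>u. of_real s * u) holomorphic_on cball 0 1"
        by (intro holomorphic_on_compose holomorphic_intros holomorphic_on_subset[OF f(1)])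
          (use in_disc in auto)
      then show "(\<lambda>u. f (of_real s * u)) holomorphic_on cball 0 1"
        by (simp add: o_def)
      show "norm (f (of_real s * 0)) \<le> r"
        using f(2) by simp
      show "\<not> (f (of_real s * u) = 0 \<or> f (of_real s * u) = 1)" if "u \<in> cball 0 1" for u
        using omits in_disc[of u] that by auto
      show "norm (z / of_real s) \<le> t / s"
        using z s by (simp add: norm_divide divide_right_mono)
    qed (use s in auto)
    then show ?thesis
      using s by simp
  qed
  moreover have "0 < B"
    by (simp add: B_def)
  ultimately show thesis
    using that by blast
qed

text \<open>
  The square root maps the slit plane to the right half-plane, and a Cayley map takes that to the
  disc, where the Schwarz lemma applies. The constant \<open>4\<close> is sharp: equality holds for the conformal
  map \<open>((1 + z) / (1 - z))\<^sup>2\<close> onto the slit plane.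
\<close>

lemma deriv_slit_plane:
  assumes hol: "g holomorphic_on ball 0 1"
    and slit: "\<And>z. norm z < 1 \<Longrightarrow> g z \<notin> \<real>\<^sub>\<le>\<^sub>0"
  shows "norm (deriv g 0) \<le> 4 * norm (g 0)"
proof -
  define q where "q z = csqrt (g z)" for z
  have q_hol: "q holomorphic_on ball 0 1"
    unfolding q_def by (intro holomorphic_on_csqrt' hol) (use slit in auto)
  have Re_q: "Re (q z) > 0" if "norm z < 1" for z
  proof (rule ccontr)
    assume "\<not> Re (q z) > 0"
    then have "Re (q z) = 0"
      using Re_csqrt[of "g z"] by (simp add: q_def del: csqrt.simps)
    then have "(q z)\<^sup>2 \<in> \<real>\<^sub>\<le>\<^sub>0"
      by (simp add: complex_nonpos_Reals_iff Re_power2 Im_power2)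
    then show False
      using slit[OF that] by (simp add: q_def)
  qed
  define Q where "Q z = (q z - q 0) / (q z + cnj (q 0))" for z
  have nz: "q z + cnj (q 0) \<noteq> 0" if "norm z < 1" for z
  proof -
    have "Re (q z + cnj (q 0)) > 0"
      using Re_q[OF that] Re_q[of 0] by simp
    then show ?thesis
      by force
  qed
  have "Q holomorphic_on ball 0 1"
    unfolding Q_def by (intro holomorphic_intros q_hol) (use nz in auto)
  moreover have "Q 0 = 0"
    by (simp add: Q_def)
  moreover have "norm (Q z) < 1" if "norm z < 1" for z
  proof -
    have "(norm (q z + cnj (q 0)))\<^sup>2 - (norm (q z - q 0))\<^sup>2 = 4 * Re (q z) * Re (q 0)"
      unfolding cmod_power2 by (simp add: power2_eq_square algebra_simps)
    also have "\<dots> > 0"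
      using Re_q[OF that] Re_q[of 0] by simp
    finally have "norm (q z - q 0) < norm (q z + cnj (q 0))"
      by (simp add: power2_less_imp_less)
    then show ?thesis
      using nz[OF that] by (simp add: Q_def norm_divide)
  qed
  ultimately have Q': "norm (deriv Q 0) \<le> 1"
    by (rule Schwarz_Lemma(2)[where \<xi> = 0]) auto
  have q0: "Re (q 0) > 0"
    using Re_q[of 0] by simp
  have dq: "(q has_field_derivative deriv q 0) (at 0)"
    using q_hol holomorphic_derivI[of q "ball 0 1" 0] by simp
  have "(Q has_field_derivative deriv q 0 / (2 * Re (q 0))) (at 0)"
  proof -
    have "(Q has_field_derivative
        (deriv q 0 * (q 0 + cnj (q 0)) - (q 0 - q 0) * deriv q 0) / ((q 0 + cnj (q 0)) * (q 0 + cnj (q 0)))) (at 0)"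
      unfolding Q_def using nz[of 0] by (auto intro!: derivative_eq_intros dq)
    moreover have "q 0 + cnj (q 0) = of_real (2 * Re (q 0))"
      by (rule complex_add_cnj)
    ultimately show ?thesis
      using q0 by (simp add: field_simps)
  qed
  then have "norm (deriv q 0) \<le> 2 * Re (q 0)"
    using Q' q0 by (simp add: DERIV_imp_deriv norm_divide divide_le_eq norm_mult)
  also have "\<dots> \<le> 2 * norm (q 0)"
    by (simp add: complex_Re_le_cmod)
  finally have q': "norm (deriv q 0) \<le> 2 * norm (q 0)" .
  have "((\<lambda>z. (q z)\<^sup>2) has_field_derivative 2 * q 0 * deriv q 0) (at 0)"
    by (auto intro!: derivative_eq_intros dq)
  then have "(g has_field_derivative 2 * q 0 * deriv q 0) (at 0)"
    by (simp add: q_def)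
  then have "norm (deriv g 0) = 2 * norm (q 0) * norm (deriv q 0)"
    by (simp add: DERIV_imp_deriv norm_mult)
  also have "\<dots> \<le> 2 * norm (q 0) * (2 * norm (q 0))"
    by (intro mult_left_mono q') auto
  also have "\<dots> = 4 * norm ((q 0)\<^sup>2)"
    by (simp add: norm_mult power2_eq_square)
  finally show ?thesis
    by (simp add: q_def)
qed

text \<open>
  For functions that omit only the discrete set \<open>0, -1, -2, \<dots>\<close>, the slit-plane estimate still holds
  asymptotically. Otherwise there are counterexamples \<open>g\<^sub>k\<close> with \<open>|g\<^sub>k 0| \<rightarrow> \<infinity>\<close>. The normalised functions
  \<open>g\<^sub>k / |g\<^sub>k 0|\<close> form a normal family, and a limit function violates the estimate for the slit plane
  although it omits the slit.
\<close>

lemma asymptotic_Landau: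
  assumes K: "4 < K"
  obtains R where "0 < R"
    "\<And>g. \<lbrakk>g holomorphic_on ball 0 1; \<And>z n. norm z < 1 \<Longrightarrow> g z \<noteq> - of_nat n; R \<le> norm (g 0)\<rbrakk>
       \<Longrightarrow> norm (deriv g 0) \<le> K * norm (g 0)"
proof (rule ccontr)
  assume contra: "\<not> thesis"
  have "\<exists>g. g holomorphic_on ball 0 1 \<and> (\<forall>z n. norm z < 1 \<longrightarrow> g z \<noteq> - of_nat n) \<and>
      real (Suc k) \<le> norm (g 0) \<and> K * norm (g 0) < norm (deriv g 0)" for k
  proof (rule ccontr)
    assume none: "\<not> ?thesis"
    have thesis
      by (rule that[of "real (Suc k)"]) (use none in \<open>auto simp: not_le\<close>)
    then show False
      using contra by blast
  qed
  then obtain g where g_hol: "\<And>k. g k holomorphic_on ball 0 1"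
    and g_omits: "\<And>k z n. norm z < 1 \<Longrightarrow> g k z \<noteq> - of_nat n"
    and g_large: "\<And>k. real (Suc k) \<le> norm (g k 0)"
    and g_deriv: "\<And>k. K * norm (g k 0) < norm (deriv (g k) 0)"
    by metis
  define r where "r k = norm (g k 0)" for k
  have r: "real (Suc k) \<le> r k" for k
    using g_large by (simp add: r_def)
  have r1: "1 \<le> r k" for k
    using r[of k] by simp
  have r_inf: "filterlim r at_top sequentially"
    by (rule filterlim_at_top_mono[OF filterlim_compose[OF filterlim_real_sequentially filterlim_Suc]])
      (use r in auto)
  define G where "G k z = g k z / of_real (r k)" for k z
  define \<H> where "\<H> = range G"
  have G_hol: "G k holomorphic_on ball 0 1" for k
    unfolding G_def by (intro holomorphic_intros g_hol) (use r1[of k] in auto)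
  have bounded: "\<exists>B. \<forall>h\<in>\<H>. \<forall>z\<in>A. norm (h z) \<le> B" if A: "compact A" "A \<subseteq> ball 0 1" for A
  proof -
    obtain t where t: "0 < t" "t < 1" "A \<subseteq> cball 0 t"
    proof (cases "A = {}")
      case True
      then show thesis
        using that[of "1/2"] by simp
    next
      case False
      then obtain a where a: "a \<in> A" "\<And>z. z \<in> A \<Longrightarrow> norm z \<le> norm a"
        using continuous_attains_sup[OF A(1) False continuous_on_norm_id] by blast
      have "norm a < 1"
        using a A by auto
      moreover have "A \<subseteq> cball 0 ((1 + norm a) / 2)"
        using a(2) \<open>norm a < 1\<close> by fastforce
      ultimately show thesis
        using norm_ge_zero[of a] by (intro that[of "(1 + norm a) / 2"]) (auto simp: add_pos_nonneg)
    qed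
    obtain B where B: "0 < B"
      "\<And>f z. \<lbrakk>f holomorphic_on ball 0 1; norm (f 0) \<le> 1;
          \<And>z. norm z < 1 \<Longrightarrow> f z \<noteq> 0 \<and> f z \<noteq> 1; norm z \<le> t\<rbrakk> \<Longrightarrow> norm (f z) \<le> B"
      using Schottky_disc[OF t(1,2), of 1] by blast
    have "norm (G k z) \<le> 2 * B" if z: "z \<in> A" for k z
    proof -
      \<comment> \<open>Dividing by an omitted integer of size about \<open>r k\<close> turns the omitted values
        into \<open>0\<close> and \<open>1\<close> and keeps the value at \<open>0\<close> bounded.\<close>
      define m where "m = nat \<lceil>r k\<rceil>"
      have m: "r k \<le> real m" "real m \<le> 2 * r k" "0 < m"
        using r1[of k] unfolding m_def by linarith+
      have "norm (- g k z / of_nat m) \<le> B"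
      proof (rule B(2)[where f = "\<lambda>z. - g k z / of_nat m"])
        show "(\<lambda>z. - g k z / of_nat m) holomorphic_on ball 0 1"
          by (intro holomorphic_intros g_hol) (use m in auto)
        show "norm (- g k 0 / of_nat m) \<le> 1"
          using m by (simp add: norm_divide r_def)
        show "- g k u / of_nat m \<noteq> 0 \<and> - g k u / of_nat m \<noteq> 1" if "norm u < 1" for u
        proof -
          have "- g k u \<noteq> of_nat m"
            using g_omits[OF that, of k m] by (metis minus_minus)
          then show ?thesis
            using g_omits[OF that, of k 0] m unfolding divide_eq_0_iff divide_eq_1_iff by simp
        qed
        show "norm z \<le> t"
          using z t by auto
      qed
      then have "norm (g k z) \<le> B * real m"
        using m by (simp add: norm_divide divide_le_eq)
      also have "\<dots> \<le> B * (2 * r k)"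
        using m B by (intro mult_left_mono) auto
      finally show ?thesis
        using r1[of k] by (simp add: G_def norm_divide divide_le_eq mult.assoc)
    qed
    then show ?thesis
      by (auto simp: \<H>_def)
  qed
  obtain g' s where g'_hol: "g' holomorphic_on ball 0 1" and s: "strict_mono (s :: nat \<Rightarrow> nat)"
    and ptw: "\<And>x. x \<in> ball 0 1 \<Longrightarrow> (\<lambda>n. G (s n) x) \<longlonglongrightarrow> g' x"
    and unif: "\<And>A. \<lbrakk>compact A; A \<subseteq> ball 0 1\<rbrakk> \<Longrightarrow> uniform_limit A (G \<circ> s) g' sequentially"
    by (rule Montel[of "ball 0 1" \<H> G]) (use bounded G_hol in \<open>auto simp: \<H>_def\<close>)
  have "norm (G k 0) = 1" for k
    using r1[of k] by (auto simp: G_def r_def norm_divide)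
  then have g'0: "norm (g' 0) = 1"
    using tendsto_norm[OF ptw[of 0]] LIMSEQ_unique[OF tendsto_const] by fastforce
  have "K \<le> norm (deriv (G k) 0)" for k
  proof -
    have "(G k has_field_derivative deriv (g k) 0 / of_real (r k)) (at 0)"
      unfolding G_def using holomorphic_derivI[OF g_hol[of k], of 0] r1[of k]
      by (auto intro!: derivative_eq_intros)
    then show ?thesis
      using g_deriv[of k] r1[of k]
      by (simp add: DERIV_imp_deriv norm_divide le_divide_eq less_imp_le flip: r_def)
  qed
  moreover have "(\<lambda>n. norm (deriv (G (s n)) 0)) \<longlonglongrightarrow> norm (deriv g' 0)"
  proof (intro tendsto_norm deriv_complex_uniform_limit[where A = "ball 0 (1/2)"])
    have "uniform_limit (cball 0 (1/2)) (G \<circ> s) g' sequentially"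
      by (rule unif) auto
    then show "uniform_limit (ball 0 (1/2)) (\<lambda>n. G (s n)) g' sequentially"
      by (metis (no_types) ball_subset_cball comp_apply ext uniform_limit_on_subset)
    show "\<forall>\<^sub>F n in sequentially. G (s n) holomorphic_on ball 0 (1/2)"
      by (intro always_eventually allI holomorphic_on_subset[OF G_hol]) auto
  qed auto
  ultimately have g'_deriv: "K \<le> norm (deriv g' 0)"
    by (intro LIMSEQ_le_const[of _ "norm (deriv g' 0)"]) auto
  have nonconst: "\<not> g' constant_on ball 0 1"
  proof
    assume "g' constant_on ball 0 1"
    then have "deriv g' 0 = 0"
      by (auto simp: constant_on_def intro!: DERIV_imp_deriv
          has_field_derivative_transform_within_open[OF DERIV_const, of "ball 0 1"])
    then show False
      using g'_deriv K by simp
  qed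
  have "g' z \<notin> \<real>\<^sub>\<le>\<^sub>0" if z: "norm z < 1" for z
  proof
    assume "g' z \<in> \<real>\<^sub>\<le>\<^sub>0"
    then obtain x where x: "0 \<le> x" "g' z = - of_real x"
      by (metis minus_minus neg_0_le_iff_le nonpos_Reals_cases of_real_minus)
    \<comment> \<open>The points \<open>- m n / r (s n)\<close> are omitted by the rescaled functions and tend to
      the point \<open>- x\<close> of the slit, so by Hurwitz's theorem the limit omits \<open>- x\<close>.\<close>
    define m where "m n = nat \<lfloor>x * r (s n)\<rfloor>" for n
    have m_lim: "(\<lambda>n. real (m n) / r (s n)) \<longlonglongrightarrow> x"
    proof (rule tendsto_sandwich)
      have rs: "filterlim (\<lambda>n. r (s n)) at_top sequentially"
        using filterlim_compose[OF r_inf filterlim_subseq[OF s]] .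
      have "(\<lambda>n. x - 1 / r (s n)) \<longlonglongrightarrow> x - 0"
        by (intro tendsto_intros tendsto_divide_0[OF tendsto_const] filterlim_at_top_imp_at_infinity rs)
      then show "(\<lambda>n. x - 1 / r (s n)) \<longlonglongrightarrow> x"
        by simp
      show "\<forall>\<^sub>F n in sequentially. x - 1 / r (s n) \<le> real (m n) / r (s n)"
      proof (intro always_eventually allI)
        fix n
        have "x * r (s n) - 1 \<le> real (m n)"
          unfolding m_def by linarith
        then have "(x * r (s n) - 1) / r (s n) \<le> real (m n) / r (s n)"
          using r1[of "s n"] by (intro divide_right_mono) auto
        then show "x - 1 / r (s n) \<le> real (m n) / r (s n)"
          using r1[of "s n"] by (simp add: diff_divide_distrib split: if_splits)
      qed
      show "\<forall>\<^sub>F n in sequentially. real (m n) / r (s n) \<le> x"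
      proof (intro always_eventually allI)
        fix n
        have "0 \<le> x * r (s n)"
          using x r1[of "s n"] by simp
        then have "real (m n) \<le> x * r (s n)"
          unfolding m_def by linarith
        then show "real (m n) / r (s n) \<le> x"
          using r1[of "s n"] by (simp add: divide_le_eq)
      qed
    qed simp
    have "g' z + of_real x \<noteq> 0"
    proof (rule Hurwitz_no_zeros[of "ball 0 1" "\<lambda>n z. G (s n) z + of_real (real (m n) / r (s n))"
          "\<lambda>z. g' z + of_real x"])
      show "(\<lambda>z. G (s n) z + of_real (real (m n) / r (s n))) holomorphic_on ball 0 1" for n
        by (intro holomorphic_intros G_hol)
      show "(\<lambda>z. g' z + of_real x) holomorphic_on ball 0 1"
        by (intro holomorphic_intros g'_hol)
      show "uniform_limit A (\<lambda>n z. G (s n) z + of_real (real (m n) / r (s n)))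
          (\<lambda>z. g' z + of_real x) sequentially" if "compact A" "A \<subseteq> ball 0 1" for A
      proof (rule uniform_limit_add)
        show "uniform_limit A (\<lambda>n. G (s n)) g' sequentially"
          using unif[OF that] by (simp add: o_def)
        show "uniform_limit A (\<lambda>n z. of_real (real (m n) / r (s n))) (\<lambda>z. complex_of_real x) sequentially"
          using tendsto_of_real[OF m_lim, where 'a = complex]
          unfolding uniform_limit_iff tendsto_iff by (auto elim: eventually_mono)
      qed
      show "\<not> (\<lambda>z. g' z + of_real x) constant_on ball 0 1"
        using nonconst unfolding constant_on_def by (metis add_diff_cancel_right')
      show "G (s n) u + of_real (real (m n) / r (s n)) \<noteq> 0" if "u \<in> ball 0 1" for n u
      proof -
        have "g (s n) u + of_nat (m n) \<noteq> 0"
          using g_omits[of u "s n" "m n"] that by (auto simp: eq_neg_iff_add_eq_0)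
        then have "(g (s n) u + of_nat (m n)) / of_real (r (s n)) \<noteq> 0"
          using r1[of "s n"] by auto
        then show ?thesis
          by (simp add: G_def add_divide_distrib)
      qed
    qed (use z in auto)
    then show False
      using x by simp
  qed
  then have "norm (deriv g' 0) \<le> 4"
    using deriv_slit_plane[OF g'_hol] g'0 by simp
  then show False
    using g'_deriv K by linarith
qed

section \<open>Growth along radii\<close>

text \<open>
  The hypothesis says that \<open>log |H|\<close> is Lipschitz with constant \<open>\<kappa>\<close> for the hyperbolic metric
  \<open>2 |dz| / (1 - |z|\<^sup>2)\<close> wherever \<open>|H| \<ge> R\<close>, and the logarithm of \<open>(1 + |z|) / (1 - |z|)\<close> is the
  hyperbolic distance from \<open>0\<close>. On the part of the radius where \<open>|H| < R\<close> there is nothing to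
  integrate, because the bound holds there already.
\<close>

lemma growth_from_hyperbolic_derivative:
  assumes hol: "H holomorphic_on ball 0 1" and nz: "\<And>z. norm z < 1 \<Longrightarrow> H z \<noteq> 0"
    and R: "0 < R" and \<kappa>: "0 \<le> \<kappa>"
    and bound: "\<And>z. \<lbrakk>norm z < 1; R \<le> norm (H z)\<rbrakk> \<Longrightarrow> (1 - (norm z)\<^sup>2) * norm (deriv H z) \<le> 2 * \<kappa> * norm (H z)"
    and z: "norm z < 1"
  shows "norm (H z) \<le> max R (norm (H 0)) * ((1 + norm z) / (1 - norm z)) powr \<kappa>"
proof -
  have "contractible (ball (0::complex) 1)"
    by (simp add: convex_imp_contractible)
  then obtain L where L: "L holomorphic_on ball 0 1" "\<And>z. z \<in> ball 0 1 \<Longrightarrow> H z = exp (L z)"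
    using contractible_imp_holomorphic_log[OF hol] nz by (metis mem_ball_0)
  define \<rho> where "\<rho> = norm z"
  have \<rho>: "0 \<le> \<rho>" "\<rho> < 1"
    using z by (auto simp: \<rho>_def)
  define M where "M = max R (norm (H 0))"
  have M: "0 < M"
    using R by (simp add: M_def)
  define \<psi> where "\<psi> t = Re (L (of_real t * z)) - \<kappa> * ln ((1 + t * \<rho>) / (1 - t * \<rho>))" for t
  have t\<rho>: "0 \<le> t * \<rho>" "t * \<rho> < 1" if "t \<in> {0..1}" for t
    using that \<rho> mult_left_le_one_le[of \<rho> t] by auto
  have in_disc: "of_real t * z \<in> ball 0 1" if "t \<in> {0..1}" for t
    using t\<rho>[OF that] that by (simp add: norm_mult \<rho>_def)
  have ReL: "norm (H u) = exp (Re (L u))" if "u \<in> ball 0 1" for u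
    using L(2)[OF that] by simp
  have \<psi>_deriv: "\<exists>D. (\<psi> has_real_derivative D) (at t) \<and> (R \<le> norm (H (of_real t * z)) \<longrightarrow> D \<le> 0)"
    if t: "t \<in> {0..1}" for t
  proof -
    define u where "u = of_real t * z"
    have u: "u \<in> ball 0 1"
      using in_disc[OF t] by (simp add: u_def)
    have dL: "(L has_field_derivative deriv L u) (at u)"
      using holomorphic_derivI[OF L(1) _ u] by simp
    have "((\<lambda>x. L (of_real x * z)) has_vector_derivative z * deriv L u) (at t)"
    proof -
      have "((\<lambda>x. of_real x * z) has_vector_derivative z) (at t)"
        by (auto intro!: derivative_eq_intros)
      then show ?thesis
        using field_vector_diff_chain_at[of "\<lambda>x. of_real x * z" z t L "deriv L u"] dL
        by (simp add: o_def u_def)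
    qed
    then have 1: "((\<lambda>x. Re (L (of_real x * z))) has_real_derivative Re (z * deriv L u)) (at t)"
      by (rule has_field_derivative_Re)
    have 2: "((\<lambda>x. ln ((1 + x * \<rho>) / (1 - x * \<rho>))) has_real_derivative 2 * \<rho> / (1 - (t * \<rho>)\<^sup>2)) (at t)"
    proof -
      have pos: "0 < 1 + t * \<rho>" "0 < 1 - t * \<rho>"
        using t\<rho>[OF t] by auto
      have "((\<lambda>x. ln ((1 + x * \<rho>) / (1 - x * \<rho>))) has_real_derivative
          ((\<rho> * (1 - t * \<rho>) - (1 + t * \<rho>) * (- \<rho>)) / ((1 - t * \<rho>) * (1 - t * \<rho>)))
            / ((1 + t * \<rho>) / (1 - t * \<rho>))) (at t)"
        using pos by (auto intro!: derivative_eq_intros)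
      moreover have "((\<rho> * (1 - t * \<rho>) - (1 + t * \<rho>) * (- \<rho>)) / ((1 - t * \<rho>) * (1 - t * \<rho>)))
            / ((1 + t * \<rho>) / (1 - t * \<rho>)) = 2 * \<rho> / ((1 - t * \<rho>) * (1 + t * \<rho>))"
      proof -
        have "\<rho> * (1 - t * \<rho>) - (1 + t * \<rho>) * (- \<rho>) = 2 * \<rho>"
          by (simp add: algebra_simps)
        then show ?thesis
          using pos by (simp only: divide_divide_eq_right divide_divide_eq_left) simp
      qed
      moreover have "(1 - t * \<rho>) * (1 + t * \<rho>) = 1 - (t * \<rho>)\<^sup>2"
        by (simp add: power2_eq_square algebra_simps)
      ultimately show ?thesis
        by simp
    qed
    have d: "(\<psi> has_real_derivative Re (z * deriv L u) - \<kappa> * (2 * \<rho> / (1 - (t * \<rho>)\<^sup>2))) (at t)"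
      unfolding \<psi>_def by (intro DERIV_diff 1 DERIV_cmult 2)
    have "Re (z * deriv L u) - \<kappa> * (2 * \<rho> / (1 - (t * \<rho>)\<^sup>2)) \<le> 0" if "R \<le> norm (H u)"
    proof -
      have "((\<lambda>w. exp (L w)) has_field_derivative exp (L u) * deriv L u) (at u)"
        by (auto intro!: derivative_eq_intros dL)
      then have "(H has_field_derivative exp (L u) * deriv L u) (at u)"
        by (rule has_field_derivative_transform_within_open[of _ _ _ "ball 0 1"]) (use u L(2) in auto)
      then have dH: "deriv H u = H u * deriv L u"
        using L(2)[OF u] by (simp add: DERIV_imp_deriv)
      have nu: "norm u = t * \<rho>"
        using t by (simp add: u_def \<rho>_def norm_mult)
      have pos: "0 < 1 - (t * \<rho>)\<^sup>2"
        using t\<rho>[OF t] by (simp add: power_less_one_iff)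
      have "(1 - (t * \<rho>)\<^sup>2) * (norm (H u) * norm (deriv L u)) \<le> 2 * \<kappa> * norm (H u)"
        using bound[of u] u that by (simp add: dH norm_mult nu)
      moreover have "0 < norm (H u)"
        using nz u by simp
      ultimately have "(1 - (t * \<rho>)\<^sup>2) * norm (deriv L u) \<le> 2 * \<kappa>"
        using mult_right_le_imp_le[of "(1 - (t * \<rho>)\<^sup>2) * norm (deriv L u)" "norm (H u)" "2 * \<kappa>"]
        by (simp only: mult_ac)
      then have "norm (deriv L u) \<le> 2 * \<kappa> / (1 - (t * \<rho>)\<^sup>2)"
        using pos by (simp add: pos_le_divide_eq mult.commute)
      then have "\<rho> * norm (deriv L u) \<le> \<rho> * (2 * \<kappa> / (1 - (t * \<rho>)\<^sup>2))"
        using \<rho> by (intro mult_left_mono) auto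
      moreover have "Re (z * deriv L u) \<le> \<rho> * norm (deriv L u)"
        unfolding \<rho>_def by (metis complex_Re_le_cmod norm_mult)
      ultimately show ?thesis
        by (simp add: mult.commute mult.left_commute)
    qed
    then show ?thesis
      using d unfolding u_def by blast
  qed
  have \<psi>_cont: "continuous_on {0..1} \<psi>"
    using \<psi>_deriv by (meson DERIV_isCont continuous_at_imp_continuous_on)
  have \<psi>_small: "\<psi> t \<le> ln M" if t: "t \<in> {0..1}" and le: "norm (H (of_real t * z)) \<le> M" for t
  proof -
    have "exp (Re (L (of_real t * z))) \<le> M"
      using le ReL[OF in_disc[OF t]] by simp
    then have "Re (L (of_real t * z)) \<le> ln M"
      using M by (simp add: ln_ge_iff)
    moreover have "0 \<le> ln ((1 + t * \<rho>) / (1 - t * \<rho>))"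
      using t\<rho>[OF t] by (intro ln_ge_zero) (auto simp: field_simps)
    then have "0 \<le> \<kappa> * ln ((1 + t * \<rho>) / (1 - t * \<rho>))"
      by (intro mult_nonneg_nonneg \<kappa>)
    ultimately show ?thesis
      by (simp add: \<psi>_def)
  qed
  have "\<psi> 1 \<le> ln M"
  proof (rule ccontr)
    assume big: "\<not> \<psi> 1 \<le> ln M"
    \<comment> \<open>After the last parameter \<open>a\<close> with \<open>\<psi> a \<le> ln M\<close>, the modulus exceeds \<open>R\<close>, so \<open>\<psi>\<close> decreases.\<close>
    define T where "T = {t \<in> {0..1}. \<psi> t \<le> ln M}"
    have "T = {0..1} \<inter> \<psi> -` {..ln M}"
      by (auto simp: T_def)
    then have "closed T"
      using continuous_closed_preimage[OF \<psi>_cont] by simp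
    then have "compact ({0..1} \<inter> T)"
      by (rule compact_Int_closed[OF compact_Icc])
    moreover have "{0..1} \<inter> T = T"
      by (auto simp: T_def)
    ultimately have "compact T"
      by simp
    moreover have "0 \<in> T"
      using \<psi>_small[of 0] by (simp add: T_def M_def)
    ultimately obtain a where a: "a \<in> T" and amax: "\<And>t. t \<in> T \<Longrightarrow> t \<le> a"
      using compact_attains_sup[of T] by blast
    have "\<psi> 1 \<le> \<psi> a"
    proof (rule DERIV_nonpos_imp_decreasing_open[of a 1 \<psi>])
      show "a \<le> 1"
        using a by (simp add: T_def)
      show "\<exists>D. (\<psi> has_real_derivative D) (at t) \<and> D \<le> 0" if "a < t" "t < 1" for t
      proof -
        have t: "t \<in> {0..1}"
          using that a by (auto simp: T_def)
        moreover have "t \<notin> T"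
          using amax that by force
        ultimately have "\<not> norm (H (of_real t * z)) \<le> M"
          using \<psi>_small[OF t] by (auto simp: T_def)
        then have "R \<le> norm (H (of_real t * z))"
          by (simp add: M_def)
        then show ?thesis
          using \<psi>_deriv[OF t] by blast
      qed
      show "continuous_on {a..1} \<psi>"
        using \<psi>_cont by (rule continuous_on_subset) (use a in \<open>auto simp: T_def\<close>)
    qed
    then show False
      using big a by (auto simp: T_def)
  qed
  then have "Re (L z) \<le> ln M + \<kappa> * ln ((1 + \<rho>) / (1 - \<rho>))"
    by (simp add: \<psi>_def)
  then have "norm (H z) \<le> exp (ln M + \<kappa> * ln ((1 + \<rho>) / (1 - \<rho>)))"
    using ReL[of z] z by simp
  also have "\<dots> = M * ((1 + \<rho>) / (1 - \<rho>)) powr \<kappa>"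
    using M \<rho> by (simp add: exp_add powr_def)
  finally show ?thesis
    by (simp add: M_def \<rho>_def)
qed

text \<open>
  Precomposition with the automorphism that takes \<open>0\<close> to \<open>z\<close> turns an estimate at the origin into one
  for the hyperbolic derivative at \<open>z\<close>. A translated disc inside the unit disc would not do: it loses
  a factor up to \<open>2\<close>, which would spoil the exponent.
\<close>

lemma deriv_Moebius_transport:
  fixes H :: "complex \<Rightarrow> complex"
  assumes hol: "H holomorphic_on ball 0 1" and z: "norm z < 1"
  shows "deriv (H \<circ> Moebius_function 0 (-z)) 0 = of_real (1 - (norm z)\<^sup>2) * deriv H z"
proof -
  have "(H has_field_derivative deriv H z) (at (Moebius_function 0 (-z) 0))"
    using holomorphic_derivI[OF hol, of z] z by (simp add: Moebius_function_of_zero)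
  moreover have "(Moebius_function 0 (-z) has_field_derivative of_real (1 - (norm z)\<^sup>2)) (at 0)"
  proof -
    have "((\<lambda>u. (u + z) / (1 + cnj z * u)) has_field_derivative (1 - z * cnj z)) (at 0)"
      by (auto intro!: derivative_eq_intros)
    then show ?thesis
      by (simp add: Moebius_function_simple[abs_def] flip: complex_norm_square)
  qed
  ultimately have "(H \<circ> Moebius_function 0 (-z) has_field_derivative deriv H z * of_real (1 - (norm z)\<^sup>2)) (at 0)"
    by (rule DERIV_chain)
  then show ?thesis
    by (simp add: DERIV_imp_deriv mult.commute)
qed

text \<open>
  The exponent is half the constant \<open>K = 2 \<kappa>\<close> in the derivative estimate, since the radial integral of
  \<open>2 \<kappa> / (1 - t\<^sup>2)\<close> is \<open>\<kappa>\<close> times the logarithm of \<open>(1 + t) / (1 - t)\<close>.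
\<close>

lemma growth_omitting_nonpos_integers:
  assumes hol: "H holomorphic_on ball 0 1"
    and omits: "\<And>z n. norm z < 1 \<Longrightarrow> H z \<noteq> - of_nat n"
    and \<kappa>: "2 < \<kappa>"
  obtains C where "0 < C" "\<And>z. norm z < 1 \<Longrightarrow> norm (H z) \<le> C * (1 - norm z) powr - \<kappa>"
proof -
  obtain R where R: "0 < R"
    "\<And>g. \<lbrakk>g holomorphic_on ball 0 1; \<And>z n. norm z < 1 \<Longrightarrow> g z \<noteq> - of_nat n; R \<le> norm (g 0)\<rbrakk>
       \<Longrightarrow> norm (deriv g 0) \<le> 2 * \<kappa> * norm (g 0)"
    using asymptotic_Landau[of "2 * \<kappa>"] \<kappa> by auto
  define M where "M = max R (norm (H 0))"
  have M: "0 < M"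
    using R by (simp add: M_def)
  have bound: "(1 - (norm z)\<^sup>2) * norm (deriv H z) \<le> 2 * \<kappa> * norm (H z)"
    if z: "norm z < 1" "R \<le> norm (H z)" for z
  proof -
    let ?g = "H \<circ> Moebius_function 0 (-z)"
    have M: "norm (Moebius_function 0 (-z) u) < 1" if "norm u < 1" for u
      using Moebius_function_norm_lt_1[of "-z" u] z that by simp
    have "norm (deriv ?g 0) \<le> 2 * \<kappa> * norm (?g 0)"
    proof (rule R(2))
      show "?g holomorphic_on ball 0 1"
        by (intro holomorphic_on_compose holomorphic_on_subset[OF hol] Moebius_function_holomorphic)
          (use z M in auto)
      show "?g u \<noteq> - of_nat n" if "norm u < 1" for u n
        using omits[OF M[OF that]] by simp
      show "R \<le> norm (?g 0)"
        using z by (simp add: Moebius_function_of_zero)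
    qed
    moreover have "0 \<le> 1 - (norm z)\<^sup>2"
      using z by (simp add: power_le_one_iff)
    ultimately show ?thesis
      unfolding deriv_Moebius_transport[OF hol z(1)] norm_mult
      by (simp add: Moebius_function_of_zero norm_of_real del: of_real_diff)
  qed
  have "norm (H z) \<le> M * 2 powr \<kappa> * (1 - norm z) powr - \<kappa>" if z: "norm z < 1" for z
  proof -
    have "norm (H z) \<le> M * ((1 + norm z) / (1 - norm z)) powr \<kappa>"
      unfolding M_def
      by (rule growth_from_hyperbolic_derivative[OF hol _ R(1) _ bound z])
        (use omits[of _ 0] \<kappa> in auto)
    also have "\<dots> \<le> M * (2 / (1 - norm z)) powr \<kappa>"
      using z M \<kappa> by (intro mult_left_mono powr_mono2 divide_right_mono) auto
    also have "\<dots> = M * 2 powr \<kappa> * (1 - norm z) powr - \<kappa>"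
      using z by (simp add: powr_divide powr_minus field_simps)
    finally show ?thesis .
  qed
  then show thesis
    using that[of "M * 2 powr \<kappa>"] M by simp
qed

section \<open>Rates of convergence of orbits\<close>

text \<open>
  Along an orbit, \<open>h - p\<close> grows linearly in \<open>n\<close>, while it is at most of order \<open>(1 - |w|)\<^sup>-\<^sup>\<kappa>\<close> at a point \<open>w\<close>;
  the rate follows with \<open>\<beta> = 1 / \<kappa>\<close>.
\<close>

lemma koenigs_orbit_rate:
  assumes hol: "h holomorphic_on ball 0 1" and maps: "f ` ball 0 1 \<subseteq> ball 0 1"
    and abel: "\<And>z. norm z < 1 \<Longrightarrow> h (f z) = h z + 1"
    and omits: "\<And>z n. norm z < 1 \<Longrightarrow> h z \<noteq> p - of_nat n"
    and z: "norm z < 1" and \<beta>: "0 < \<beta>" "\<beta> < 1/2"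
  shows "\<exists>C>0. \<forall>\<^sub>F n in sequentially. 1 - norm ((f ^^ n) z) \<le> C * real n powr - \<beta>"
proof -
  define H where "H u = h u - p" for u
  define \<kappa> where "\<kappa> = 1 / \<beta>"
  have \<kappa>: "2 < \<kappa>"
    using \<beta> by (simp add: \<kappa>_def field_simps)
  have "H holomorphic_on ball 0 1"
    unfolding H_def by (intro holomorphic_intros hol)
  moreover have "H u \<noteq> - of_nat n" if "norm u < 1" for u n
    using omits[OF that, of n] by (auto simp: H_def algebra_simps)
  ultimately obtain C where C: "0 < C" "\<And>u. norm u < 1 \<Longrightarrow> norm (H u) \<le> C * (1 - norm u) powr - \<kappa>"
    using growth_omitting_nonpos_integers[OF _ _ \<kappa>] by metis
  have in_disc: "norm ((f ^^ n) z) < 1" for n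
    by (rule orbit_in_disc[OF maps z])
  have translate: "H ((f ^^ n) z) = H z + of_nat n" for n
    by (induction n) (use abel in_disc in \<open>auto simp: H_def algebra_simps\<close>)
  have "1 - norm ((f ^^ n) z) \<le> (2 * C) powr \<beta> * real n powr - \<beta>"
    if n: "0 < n" "2 * norm (H z) \<le> real n" for n
  proof -
    define d where "d = 1 - norm ((f ^^ n) z)"
    have d: "0 < d"
      using in_disc[of n] by (simp add: d_def)
    have "real n - norm (H z) \<le> norm (H ((f ^^ n) z))"
      using norm_triangle_ineq2[of "of_nat n" "- H z"] by (simp add: translate add.commute)
    also have "\<dots> \<le> C * d powr - \<kappa>"
      using C(2)[OF in_disc] by (simp add: d_def)
    finally have "real n \<le> 2 * C * d powr - \<kappa>"
      using n by linarith
    then have "d powr \<kappa> \<le> 2 * C / real n"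
      using n d by (simp add: powr_minus field_simps)
    then have "(d powr \<kappa>) powr \<beta> \<le> (2 * C / real n) powr \<beta>"
      using \<beta> by (intro powr_mono2) auto
    then show ?thesis
      using n d C \<beta> by (simp add: powr_powr \<kappa>_def powr_divide powr_minus d_def field_simps)
  qed
  moreover have "\<forall>\<^sub>F n in sequentially. 0 < n \<and> 2 * norm (H z) \<le> real n"
    by (intro eventually_conj eventually_gt_at_top)
      (use filterlim_real_sequentially in \<open>simp add: filterlim_at_top\<close>)
  ultimately show ?thesis
    using C by (intro exI[of _ "(2 * C) powr \<beta>"] conjI) (auto elim!: eventually_mono)
qed

text \<open>
  The constant \<open>C\<close> disappears in the limit after division by \<open>ln n\<close>, so exponents arbitrarily close to
  \<open>\<alpha>\<close> suffice. This is why the growth estimate may lose an arbitrarily small amount in \<open>\<kappa>\<close>.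
\<close>

lemma limsup_log_ratio:
  fixes u :: "nat \<Rightarrow> real"
  assumes pos: "\<And>n. 0 < u n" and \<alpha>: "0 < \<alpha>"
    and bound: "\<And>\<beta>. \<lbrakk>0 < \<beta>; \<beta> < \<alpha>\<rbrakk> \<Longrightarrow> \<exists>C>0. \<forall>\<^sub>F n in sequentially. u n \<le> C * real n powr - \<beta>"
  shows "limsup (\<lambda>n. ereal (ln (u n) / ln (real n))) \<le> ereal (- \<alpha>)"
proof -
  have step: "limsup (\<lambda>n. ereal (ln (u n) / ln (real n))) \<le> ereal (- \<beta>)" if \<beta>: "0 < \<beta>" "\<beta> < \<alpha>" for \<beta>
  proof -
    obtain C where C: "0 < C" "\<forall>\<^sub>F n in sequentially. u n \<le> C * real n powr - \<beta>"
      using bound[OF \<beta>] by blast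
    have ln_inf: "filterlim (\<lambda>n. ln (real n)) at_top sequentially"
      by (rule filterlim_compose[OF ln_at_top filterlim_real_sequentially])
    have "\<forall>\<^sub>F n in sequentially. ln (u n) / ln (real n) \<le> ln C / ln (real n) - \<beta>"
      using C(2) eventually_gt_at_top[of 1]
    proof eventually_elim
      case (elim n)
      have "ln (u n) \<le> ln (C * real n powr - \<beta>)"
        using elim pos by (intro ln_mono) auto
      also have "\<dots> = ln C - \<beta> * ln (real n)"
        using C elim by (simp add: ln_mult ln_powr)
      finally show ?case
        using elim by (simp add: field_simps)
    qed
    then have "limsup (\<lambda>n. ereal (ln (u n) / ln (real n))) \<le> limsup (\<lambda>n. ereal (ln C / ln (real n) - \<beta>))"
      by (intro Limsup_mono) (auto elim: eventually_mono)
    also have "\<dots> = ereal (0 - \<beta>)"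
    proof (intro lim_imp_Limsup tendsto_ereal tendsto_diff tendsto_const)
      show "(\<lambda>n. ln C / ln (real n)) \<longlonglongrightarrow> 0"
        by (intro tendsto_divide_0[OF tendsto_const] filterlim_at_top_imp_at_infinity ln_inf)
    qed simp
    finally show ?thesis
      by simp
  qed
  show ?thesis
  proof (rule ereal_le_epsilon2)
    fix e :: real
    assume "0 < e"
    then have "limsup (\<lambda>n. ereal (ln (u n) / ln (real n))) \<le> ereal (- max (\<alpha> / 2) (\<alpha> - e))"
      using \<alpha> by (intro step) auto
    also have "\<dots> \<le> ereal (- \<alpha>) + ereal e"
      by simp
    finally show "limsup (\<lambda>n. ereal (ln (u n) / ln (real n))) \<le> ereal (- \<alpha>) + ereal e" .
  qed
qed

theorem corollary1p2:
  fixes f h :: "complex \<Rightarrow> complex" and \<tau> :: complex and \<Omega> :: "complex set"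
  assumes "non_elliptic f"
    and "denjoy_wolff_point f \<tau>"
    and "koenigs_pair f \<Omega> h"
    and "\<Omega> \<noteq> UNIV"
  shows "(\<forall>z\<in>unit_disc.
            limsup (\<lambda>n. ereal (ln (cmod ((f ^^ n) z - \<tau>)) / ln (real n))) \<le> ereal (- 1 / 4)) \<and>
         ((\<exists>z0\<in>unit_disc. converges_nontangentially (\<lambda>n. (f ^^ n) z0) \<tau>) \<longrightarrow>
          (\<forall>z\<in>unit_disc.
            limsup (\<lambda>n. ereal (ln (cmod ((f ^^ n) z - \<tau>)) / ln (real n))) \<le> ereal (- 1 / 2)))"
proof -
  have f_hol: "f holomorphic_on ball 0 1" and maps: "f ` ball 0 1 \<subseteq> ball 0 1"
    using assms(1) by (auto simp: non_elliptic_def self_map_disc_def)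
  have \<tau>: "norm \<tau> = 1"
    using assms(2) by (simp add: denjoy_wolff_point_def)
  have h_hol: "h holomorphic_on ball 0 1" and h_img: "h ` ball 0 1 = \<Omega>"
    and abel: "\<And>z. norm z < 1 \<Longrightarrow> h (f z) = h z + 1"
    and shift: "\<And>w. w \<in> \<Omega> \<Longrightarrow> w + 1 \<in> \<Omega>"
    using assms(3) by (auto simp: koenigs_pair_def asymptotically_starlike_at_infinity_def)
  obtain p where p: "p \<notin> \<Omega>"
    using assms(4) by blast
  have shifts: "w + of_nat n \<in> \<Omega>" if "w \<in> \<Omega>" for w n
    by (induction n) (use that shift in \<open>auto simp: add.assoc[symmetric] add.commute[of 1]\<close>)
  have omits: "h z \<noteq> p - of_nat n" if "norm z < 1" for z n
  proof
    assume "h z = p - of_nat n"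
    moreover have "h z + of_nat n \<in> \<Omega>"
      using shifts h_img that by auto
    ultimately show False
      using p by simp
  qed
  have rate: "\<exists>C>0. \<forall>\<^sub>F n in sequentially. 1 - norm ((f ^^ n) z) \<le> C * real n powr - \<beta>"
    if "norm z < 1" "0 < \<beta>" "\<beta> < 1/2" for z \<beta>
    by (rule koenigs_orbit_rate[OF h_hol maps abel omits that])
  have in_disc: "norm ((f ^^ n) z) < 1" if "norm z < 1" for z n
    by (rule orbit_in_disc[OF maps that])
  have dist_pos: "0 < norm ((f ^^ n) z - \<tau>)" if "norm z < 1" for z n
    using in_disc[OF that, of n] \<tau> by auto
  have "limsup (\<lambda>n. ereal (ln (norm ((f ^^ n) z - \<tau>)) / ln (real n))) \<le> ereal (- (1 / 4))"
    if z: "norm z < 1" for z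
  proof (rule limsup_log_ratio)
    fix \<beta> :: real
    assume \<beta>: "0 < \<beta>" "\<beta> < 1/4"
    obtain K where K: "0 < K" "\<And>n. (norm ((f ^^ n) z - \<tau>))\<^sup>2 \<le> K * (1 - norm ((f ^^ n) z))"
      using orbit_horodisc[OF assms(1,2) z] by blast
    obtain C where C: "0 < C"
      "\<forall>\<^sub>F n in sequentially. 1 - norm ((f ^^ n) z) \<le> C * real n powr - (2 * \<beta>)"
      using rate[OF z, of "2 * \<beta>"] \<beta> by auto
    have "\<forall>\<^sub>F n in sequentially. norm ((f ^^ n) z - \<tau>) \<le> sqrt (K * C) * real n powr - \<beta>"
      using C(2)
    proof eventually_elim
      case (elim n)
      have "(norm ((f ^^ n) z - \<tau>))\<^sup>2 \<le> K * (C * real n powr - (2 * \<beta>))"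
        using K(2)[of n] mult_left_mono[OF elim, of K] K(1) by linarith
      also have "\<dots> = (sqrt (K * C) * real n powr - \<beta>)\<^sup>2"
      proof -
        have "real n powr - (2 * \<beta>) = (real n powr - \<beta>)\<^sup>2"
          by (simp add: power2_eq_square flip: powr_add)
        then show ?thesis
          using K C by (simp add: power_mult_distrib)
      qed
      finally show ?case
        by (rule power2_le_imp_le) (use K C in simp)
    qed
    then show "\<exists>C>0. \<forall>\<^sub>F n in sequentially. norm ((f ^^ n) z - \<tau>) \<le> C * real n powr - \<beta>"
      using K C by (intro exI[of _ "sqrt (K * C)"]) auto
  qed (use dist_pos[OF z] in auto)
  moreover have "limsup (\<lambda>n. ereal (ln (norm ((f ^^ n) z - \<tau>)) / ln (real n))) \<le> ereal (- (1 / 2))"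
    if z: "norm z < 1" and w: "norm w < 1" and nt: "converges_nontangentially (\<lambda>n. (f ^^ n) w) \<tau>" for z w
  proof (rule limsup_log_ratio)
    fix \<beta> :: real
    assume \<beta>: "0 < \<beta>" "\<beta> < 1/2"
    obtain R where R: "1 < R" "\<And>n. norm (\<tau> - (f ^^ n) w) < R * (1 - norm ((f ^^ n) w))"
      using nt by (auto simp: converges_nontangentially_def)
    obtain K where K: "0 \<le> K" "\<And>n. norm ((f ^^ n) z - (f ^^ n) w) \<le> K * (1 - norm ((f ^^ n) w))"
      using orbits_comparable[OF f_hol maps w z] by blast
    obtain C where C: "0 < C" "\<forall>\<^sub>F n in sequentially. 1 - norm ((f ^^ n) w) \<le> C * real n powr - \<beta>"
      using rate[OF w \<beta>] by blast
    have "\<forall>\<^sub>F n in sequentially. norm ((f ^^ n) z - \<tau>) \<le> (K + R) * C * real n powr - \<beta>"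
      using C(2)
    proof eventually_elim
      case (elim n)
      have "norm ((f ^^ n) z - \<tau>) \<le> norm ((f ^^ n) z - (f ^^ n) w) + norm (\<tau> - (f ^^ n) w)"
        using norm_triangle_ineq4[of "(f ^^ n) z - (f ^^ n) w" "\<tau> - (f ^^ n) w"] by simp
      also have "\<dots> \<le> (K + R) * (1 - norm ((f ^^ n) w))"
        using K(2)[of n] R(2)[of n] by (simp add: distrib_right)
      also have "\<dots> \<le> (K + R) * (C * real n powr - \<beta>)"
        using elim K R by (intro mult_left_mono) auto
      finally show ?case
        by (simp add: mult.assoc)
    qed
    then show "\<exists>C>0. \<forall>\<^sub>F n in sequentially. norm ((f ^^ n) z - \<tau>) \<le> C * real n powr - \<beta>"
      using K R C by (intro exI[of _ "(K + R) * C"]) auto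
  qed (use dist_pos[OF z] in auto)
  ultimately show ?thesis
    by auto
qed

end
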